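(* Let $\Sigma=(X,\mathcal{U},\phi)$ be a control system. The following statements are equivalent: (i) $\Sigma$ is ISpS. (ii) There is a bounded nonempty $0$-invariant set $\mathcal{A}\subset X$ such that $\Sigma$ is CUAG with respect to $\mathcal{A}$. (iii) $\Sigma$ is BRS and there is a bounded nonempty set $\mathcal{A}\subset X$ such that $\Sigma$ is ULIM with respect to $\mathcal{A}$.
   Context: Notation: $\mathbb{R}_+=[0,\infty)$. For a nonempty subset $\mathcal{A}$ of a normed space $(X,\|\cdot\|)$, $\|x\|_{\mathcal{A}}:=\inf_{y\in\mathcal{A}}\|x-y\|$. $\mathcal{K}$: continuous strictly increasing $\gamma:\mathbb{R}_+\to\mathbb{R}_+$ with $\gamma(0)=0$; $\mathcal{K}_\infty$: unbounded elements of $\mathcal{K}$; $\mathcal{L}$: continuous strictly decreasing $\gamma:\mathbb{R}_+\to\mathbb{R}_+$ with $\lim_{t\to\infty}\gamma(t)=0$; $\mathcal{KL}$: continuous $\beta:\mathbb{R}_+\times\mathbb{R}_+\to\mathbb{R}_+$ with $\beta(\cdot,t)\in\mathcal{K}$ for all $t\ge0$ and $\beta(r,\cdot)\in\mathcal{L}$ for all $r>0$. Control system: a triple $\Sigma=(X,\mathcal{U},\phi)$ where $(X,\|\cdot\|)$ is a normed linear space (state space); $\mathcal{U}\subset\{f:\mathbb{R}_+\to U\}$, with $U$ a nonempty subset of a normed linear space, is a space of inputs with $0\in\mathcal{U}$, endowed with a norm $\|\cdot\|_{\mathcal{U}}$, satisfying: (shift invariance) for all $u\in\mathcal{U}$,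 $\tau\ge0$: $u(\cdot+\tau)\in\mathcal{U}$ and $\|u(\cdot+\tau)\|_{\mathcal{U}}\le\|u\|_{\mathcal{U}}$; (concatenation) for all $u_1,u_2\in\mathcal{U}$, $t>0$ the function $u$ with $u(\tau)=u_1(\tau)$ for $\tau\in[0,t]$ and $u(\tau)=u_2(\tau-t)$ for $\tau>t$ belongs to $\mathcal{U}$, and if $u_2\equiv0$ then $\|u\|_{\mathcal{U}}\le\|u_1\|_{\mathcal{U}}$; and $\phi:\mathbb{R}_+\times X\times\mathcal{U}\to X$ is a map (defined for all $(t,x,u)$) with: $\phi(0,x,u)=x$; (causality) if $u,\tilde u\in\mathcal{U}$ and $u(s)=\tilde u(s)$ for all $s\in[0,t]$ then $\phi(t,x,u)=\phi(t,x,\tilde u)$; (continuity) $t\mapsto\phi(t,x,u)$ is continuous for each $(x,u)$; (cocycle) $\phi(h,\phi(t,x,u),u(t+\cdot))=\phi(t+h,x,u)$ for all $t,h\ge0$, $x\in X$, $u\in\mathcal{U}$. $\mathcal{A}$ is $0$-invariant if $\phi(t,x,0)\in\mathcal{A}$ for all $t\ge0$, $x\in\mathcal{A}$. ISpS w.r.t. nonempty $\mathcal{A}$: there exist $\beta\in\mathcal{KL}$, $\gamma\in\mathcal{K}_\infty$, $c>0$ such that $\|\phi(t,x,u)\|_{\mathcal{A}}\le\beta(\|x\|_{\mathcal{A}},t)+\gamma(\|u\|_{\mathcal{U}})+c$ for all $x\in X,u\in\mathcal{U},t\ge0$. $\Sigma$ is ISpS if it is ISpS w.r.t. some bounded nonempty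 $\mathcal{A}\subset X$. BRS (bounded reachability sets): for all $C>0$, $\tau>0$: $\sup\{\|\phi(t,x,u)\|:\|x\|\le C,\|u\|_{\mathcal{U}}\le C,t\in[0,\tau]\}<\infty$. CUAG w.r.t. $\mathcal{A}$: there are $\beta\in\mathcal{KL}$, $\gamma\in\mathcal{K}_\infty$, $C>0$ such that $\|\phi(t,x,u)\|_{\mathcal{A}}\le\beta(\|x\|_{\mathcal{A}}+C,t)+\gamma(\|u\|_{\mathcal{U}})$ for all $x\in X,u\in\mathcal{U},t\ge0$. ULIM w.r.t. $\mathcal{A}$: there is $\gamma\in\mathcal{K}_\infty$ such that for all $\varepsilon>0$, $r>0$ there is $\tau=\tau(\varepsilon,r)<\infty$ such that for all $u\in\mathcal{U}$ and all $x\in X$ with $\|x\|_{\mathcal{A}}\le r$ there exists $t\le\tau$ ($t\ge 0$) with $\|\phi(t,x,u)\|_{\mathcal{A}}\le\varepsilon+\gamma(\|u\|_{\mathcal{U}})$. *)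

theory Defs
  imports "HOL-Analysis.Analysis"
begin

section \<open>Comparison functions\<close>

text \<open>Functions on the half-line are total functions on the reals of which only the restriction to
  the set of nonnegative reals matters.\<close>

definition class_K :: "(real \<Rightarrow> real) set" where
  "class_K = {\<gamma>. \<gamma> \<in> {0..} \<rightarrow> {0..} \<and> continuous_on {0..} \<gamma> \<and> strict_mono_on {0..} \<gamma> \<and> \<gamma> 0 = 0}"

definition class_K_inf :: "(real \<Rightarrow> real) set" where
  "class_K_inf = {\<gamma> \<in> class_K. \<not> bdd_above (\<gamma> ` {0..})}"

definition class_L :: "(real \<Rightarrow> real) set" where
  "class_L = {\<gamma>. \<gamma> \<in> {0..} \<rightarrow> {0..} \<and> continuous_on {0..} \<gamma> \<and> strict_antimono_on {0..} \<gamma>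
                 \<and> (\<gamma> \<longlongrightarrow> 0) at_top}"

definition class_KL :: "(real \<Rightarrow> real \<Rightarrow> real) set" where
  "class_KL = {\<beta>. continuous_on ({0..} \<times> {0..}) (\<lambda>(r, t). \<beta> r t)
                  \<and> (\<forall>t\<ge>0. (\<lambda>r. \<beta> r t) \<in> class_K) \<and> (\<forall>r>0. \<beta> r \<in> class_L)}"


section \<open>Control systems\<close>

text \<open>An input on the half-line is encoded by its extension by 0 to negative times, so that equality
  of encoded inputs is equality on the half-line.\<close>

definition shift_input :: "real \<Rightarrow> (real \<Rightarrow> 'u) \<Rightarrow> (real \<Rightarrow> 'u::real_normed_vector)" where
  "shift_input \<tau> u = (\<lambda>s. if 0 \<le> s then u (s + \<tau>) else 0)"

definition concat_input :: "real \<Rightarrow> (real \<Rightarrow> 'u) \<Rightarrow> (real \<Rightarrow> 'u) \<Rightarrow> (real \<Rightarrow> 'u::real_normed_vector)" where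
  "concat_input t u1 u2 = (\<lambda>s. if s \<le> t then u1 s else u2 (s - t))"

text \<open>The set of input values, and hence the set of inputs, need not be closed under the linear
  operations. The norm on the inputs is therefore the restriction of a norm on a
  linear space \<open>V\<close> of functions on the half-line; \<open>V\<close> is the set of inputs itself when
  that is a linear space.\<close>

locale input_space =
  fixes V :: "(real \<Rightarrow> 'u::real_normed_vector) set"
    and normU :: "(real \<Rightarrow> 'u) \<Rightarrow> real"
    and U :: "'u set"
    and \<U> :: "(real \<Rightarrow> 'u) set"
  assumes V_half_line: "v \<in> V \<Longrightarrow> t < 0 \<Longrightarrow> v t = 0"
    and V_zero: "(\<lambda>_. 0) \<in> V"
    and V_add: "v \<in> V \<Longrightarrow> w \<in> V \<Longrightarrow> (\<lambda>t. v t + w t) \<in> V"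
    and V_scale: "v \<in> V \<Longrightarrow> (\<lambda>t. a *\<^sub>R v t) \<in> V"
    and normU_eq_0: "v \<in> V \<Longrightarrow> normU v = 0 \<longleftrightarrow> v = (\<lambda>_. 0)"
    and normU_triangle: "v \<in> V \<Longrightarrow> w \<in> V \<Longrightarrow> normU (\<lambda>t. v t + w t) \<le> normU v + normU w"
    and normU_scale: "v \<in> V \<Longrightarrow> normU (\<lambda>t. a *\<^sub>R v t) = \<bar>a\<bar> * normU v"
    and U_nonempty: "U \<noteq> {}"
    and inputs_subset: "\<U> \<subseteq> V"
    and input_values: "u \<in> \<U> \<Longrightarrow> 0 \<le> t \<Longrightarrow> u t \<in> U"
    and zero_input: "(\<lambda>_. 0) \<in> \<U>"
    and shift_closed: "u \<in> \<U> \<Longrightarrow> 0 \<le> \<tau> \<Longrightarrow> shift_input \<tau> u \<in> \<U>"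
    and shift_norm: "u \<in> \<U> \<Longrightarrow> 0 \<le> \<tau> \<Longrightarrow> normU (shift_input \<tau> u) \<le> normU u"
    and concat_closed: "u1 \<in> \<U> \<Longrightarrow> u2 \<in> \<U> \<Longrightarrow> 0 < t \<Longrightarrow> concat_input t u1 u2 \<in> \<U>"
    and concat_zero_norm: "u1 \<in> \<U> \<Longrightarrow> 0 < t \<Longrightarrow> normU (concat_input t u1 (\<lambda>_. 0)) \<le> normU u1"

locale control_system = input_space V normU U \<U>
  for V :: "(real \<Rightarrow> 'u::real_normed_vector) set"
    and normU :: "(real \<Rightarrow> 'u) \<Rightarrow> real"
    and U :: "'u set"
    and \<U> :: "(real \<Rightarrow> 'u) set" +
  fixes \<phi> :: "real \<Rightarrow> 'x::real_normed_vector \<Rightarrow> (real \<Rightarrow> 'u) \<Rightarrow> 'x"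
  assumes initial: "u \<in> \<U> \<Longrightarrow> \<phi> 0 x u = x"
    and causality: "u \<in> \<U> \<Longrightarrow> u' \<in> \<U> \<Longrightarrow> 0 \<le> t \<Longrightarrow> (\<And>s. 0 \<le> s \<Longrightarrow> s \<le> t \<Longrightarrow> u s = u' s)
                    \<Longrightarrow> \<phi> t x u = \<phi> t x u'"
    and continuity: "u \<in> \<U> \<Longrightarrow> continuous_on {0..} (\<lambda>t. \<phi> t x u)"
    and cocycle: "u \<in> \<U> \<Longrightarrow> 0 \<le> t \<Longrightarrow> 0 \<le> h \<Longrightarrow> \<phi> h (\<phi> t x u) (shift_input t u) = \<phi> (t + h) x u"


section \<open>Stability notions\<close>

text \<open>For nonempty \<open>A\<close>, \<open>infdist x A\<close> is the infimum of \<open>norm (x - y)\<close> over \<open>y\<close> in \<open>A\<close>.\<close>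

definition zero_invariant ::
  "(real \<Rightarrow> 'x::real_normed_vector \<Rightarrow> (real \<Rightarrow> 'u::real_normed_vector) \<Rightarrow> 'x) \<Rightarrow> 'x set \<Rightarrow> bool" where
  "zero_invariant \<phi> A \<longleftrightarrow> (\<forall>t\<ge>0. \<forall>x\<in>A. \<phi> t x (\<lambda>_. 0) \<in> A)"

definition ISpS_wrt ::
  "((real \<Rightarrow> 'u::real_normed_vector) \<Rightarrow> real) \<Rightarrow> (real \<Rightarrow> 'u) set
   \<Rightarrow> (real \<Rightarrow> 'x::real_normed_vector \<Rightarrow> (real \<Rightarrow> 'u) \<Rightarrow> 'x) \<Rightarrow> 'x set \<Rightarrow> bool" where
  "ISpS_wrt normU \<U> \<phi> A \<longleftrightarrow>
     (\<exists>\<beta>\<in>class_KL. \<exists>\<gamma>\<in>class_K_inf. \<exists>c>0. \<forall>x. \<forall>u\<in>\<U>. \<forall>t\<ge>0.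
        infdist (\<phi> t x u) A \<le> \<beta> (infdist x A) t + \<gamma> (normU u) + c)"

definition ISpS ::
  "((real \<Rightarrow> 'u::real_normed_vector) \<Rightarrow> real) \<Rightarrow> (real \<Rightarrow> 'u) set
   \<Rightarrow> (real \<Rightarrow> 'x::real_normed_vector \<Rightarrow> (real \<Rightarrow> 'u) \<Rightarrow> 'x) \<Rightarrow> bool" where
  "ISpS normU \<U> \<phi> \<longleftrightarrow> (\<exists>A. bounded A \<and> A \<noteq> {} \<and> ISpS_wrt normU \<U> \<phi> A)"

definition BRS ::
  "((real \<Rightarrow> 'u::real_normed_vector) \<Rightarrow> real) \<Rightarrow> (real \<Rightarrow> 'u) set
   \<Rightarrow> (real \<Rightarrow> 'x::real_normed_vector \<Rightarrow> (real \<Rightarrow> 'u) \<Rightarrow> 'x) \<Rightarrow> bool" where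
  "BRS normU \<U> \<phi> \<longleftrightarrow>
     (\<forall>C>0. \<forall>\<tau>>0. bdd_above {norm (\<phi> t x u) | t x u.
        norm x \<le> C \<and> u \<in> \<U> \<and> normU u \<le> C \<and> t \<in> {0..\<tau>}})"

definition CUAG_wrt ::
  "((real \<Rightarrow> 'u::real_normed_vector) \<Rightarrow> real) \<Rightarrow> (real \<Rightarrow> 'u) set
   \<Rightarrow> (real \<Rightarrow> 'x::real_normed_vector \<Rightarrow> (real \<Rightarrow> 'u) \<Rightarrow> 'x) \<Rightarrow> 'x set \<Rightarrow> bool" where
  "CUAG_wrt normU \<U> \<phi> A \<longleftrightarrow>
     (\<exists>\<beta>\<in>class_KL. \<exists>\<gamma>\<in>class_K_inf. \<exists>C>0. \<forall>x. \<forall>u\<in>\<U>. \<forall>t\<ge>0.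
        infdist (\<phi> t x u) A \<le> \<beta> (infdist x A + C) t + \<gamma> (normU u))"

definition ULIM_wrt ::
  "((real \<Rightarrow> 'u::real_normed_vector) \<Rightarrow> real) \<Rightarrow> (real \<Rightarrow> 'u) set
   \<Rightarrow> (real \<Rightarrow> 'x::real_normed_vector \<Rightarrow> (real \<Rightarrow> 'u) \<Rightarrow> 'x) \<Rightarrow> 'x set \<Rightarrow> bool" where
  "ULIM_wrt normU \<U> \<phi> A \<longleftrightarrow>
     (\<exists>\<gamma>\<in>class_K_inf. \<forall>\<epsilon>>0. \<forall>r>0. \<exists>\<tau>::real. \<forall>u\<in>\<U>. \<forall>x. infdist x A \<le> r \<longrightarrow>
        (\<exists>t. 0 \<le> t \<and> t \<le> \<tau> \<and> infdist (\<phi> t x u) A \<le> \<epsilon> + \<gamma> (normU u)))"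

end

theory Submission
  imports Defs
begin

text \<open>Because the attracting set is bounded, distance to it and norm differ by at most a constant,
  and every constant can be absorbed into \<open>c\<close> or into a larger set.

  From ISpS to CUAG, replace the given set by everything that is reached with zero input from a ball
  whose radius exceeds the offset \<open>c\<close>: the distance to the new set swallows \<open>c\<close>. Conversely,
  \<open>\<beta> (r + C) t \<le> \<beta> (2 * r) t + \<beta> (2 * C) 0\<close>.

  From BRS and ULIM to ISpS, a trajectory that returns to a ball, waits for one unit of time and is
  then attracted again returns with gaps that are bounded above and below, so BRS bounds it for all times by
  \<open>g (norm x) + g (normU u) + c\<close>. After a time \<open>g (norm x) + c\<close> it has visited a ball
  whose radius depends on the input only, so the dependence on \<open>x\<close> may be switched off by
  the factor \<open>exp (- t / (g (norm x) + c))\<close>.\<close>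

section \<open>Comparison functions\<close>

lemma class_K_nonneg: "\<gamma> \<in> class_K \<Longrightarrow> 0 \<le> r \<Longrightarrow> 0 \<le> \<gamma> r"
  by (auto simp: class_K_def)

lemma class_K_strict_mono: "\<gamma> \<in> class_K \<Longrightarrow> 0 \<le> r \<Longrightarrow> r < s \<Longrightarrow> \<gamma> r < \<gamma> s"
  by (auto simp: class_K_def intro: strict_mono_onD)

lemma class_K_mono: "\<gamma> \<in> class_K \<Longrightarrow> 0 \<le> r \<Longrightarrow> r \<le> s \<Longrightarrow> \<gamma> r \<le> \<gamma> s"
  using class_K_strict_mono[of \<gamma> r s] by (cases "r = s") auto

text \<open>A weak triangle inequality: the sum of the arguments is at most twice the larger one,
  and the term belonging to the smaller one is nonnegative.\<close>

lemma class_K_add_le: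
  assumes "\<gamma> \<in> class_K" "0 \<le> r" "0 \<le> s"
  shows "\<gamma> (r + s) \<le> \<gamma> (2 * r) + \<gamma> (2 * s)"
proof (cases "r \<le> s")
  case True
  then show ?thesis
    using class_K_mono[OF assms(1), of "r + s" "2 * s"] class_K_nonneg[OF assms(1), of "2 * r"] assms
    by simp
next
  case False
  then show ?thesis
    using class_K_mono[OF assms(1), of "r + s" "2 * r"] class_K_nonneg[OF assms(1), of "2 * s"] assms
    by simp
qed

lemma class_K_inf_K: "\<gamma> \<in> class_K_inf \<Longrightarrow> \<gamma> \<in> class_K"
  by (simp add: class_K_inf_def)

lemma class_K_add:
  assumes "f \<in> class_K" "g \<in> class_K"
  shows "(\<lambda>r. f r + g r) \<in> class_K"
proof -
  have "strict_mono_on {0..} (\<lambda>r. f r + g r)"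
    by (rule strict_mono_onI)
      (auto intro: add_strict_mono class_K_strict_mono[OF assms(1)] class_K_strict_mono[OF assms(2)])
  with assms show ?thesis
    unfolding class_K_def by (auto intro!: continuous_on_add add_nonneg_nonneg)
qed

lemma class_K_compose:
  assumes "f \<in> class_K" "g \<in> class_K"
  shows "(\<lambda>r. f (g r)) \<in> class_K"
proof -
  have "strict_mono_on {0..} (\<lambda>r. f (g r))"
    by (rule strict_mono_onI)
      (auto intro: class_K_strict_mono[OF assms(1)] class_K_strict_mono[OF assms(2)]
        class_K_nonneg[OF assms(2)])
  moreover have "continuous_on {0..} (\<lambda>r. f (g r))"
  proof (rule continuous_on_compose2[of "{0..}" f _ g])
    show "continuous_on {0..} f" "continuous_on {0..} g"
      using assms by (simp_all add: class_K_def)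
    show "g ` {0..} \<subseteq> {0..}"
      by (intro image_subsetI) (simp add: class_K_nonneg[OF assms(2)])
  qed
  moreover have "f (g 0) = 0"
    using assms by (simp add: class_K_def)
  ultimately show ?thesis
    using class_K_nonneg[OF assms(1) class_K_nonneg[OF assms(2)]] by (simp add: class_K_def)
qed

lemma class_K_scale: "0 < a \<Longrightarrow> (\<lambda>r. a * r) \<in> class_K"
  by (auto simp: class_K_def intro!: strict_mono_onI continuous_intros)

lemma class_K_inf_above:
  assumes "f \<in> class_K" "g \<in> class_K_inf" "\<And>r. 0 \<le> r \<Longrightarrow> g r \<le> f r"
  shows "f \<in> class_K_inf"
proof -
  have "bdd_above (g ` {0..})" if "bdd_above (f ` {0..})"
  proof -
    from that obtain B where "\<And>r. 0 \<le> r \<Longrightarrow> f r \<le> B"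
      by (auto simp: bdd_above_def)
    then show ?thesis
      using assms(3) by (intro bdd_aboveI2[of _ _ B]) (auto intro: order_trans)
  qed
  with assms show ?thesis by (auto simp: class_K_inf_def)
qed

lemma id_class_K_inf: "(\<lambda>r. r) \<in> class_K_inf"
proof -
  have "\<not> bdd_above ((\<lambda>r::real. r) ` {0..})"
  proof
    assume "bdd_above ((\<lambda>r::real. r) ` {0..})"
    then obtain B where B: "\<And>r::real. 0 \<le> r \<Longrightarrow> r \<le> B" by (auto simp: bdd_above_def)
    from B[of "max 0 (B + 1)"] show False by simp
  qed
  then show ?thesis
    using class_K_scale[of 1] by (simp add: class_K_inf_def)
qed

text \<open>Boundedness and attraction supply one constant per integer radius, with no monotonicity
  or continuity in the radius. Adding up piecewise linear ramps turns any such sequence into a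
  comparison function plus a constant.\<close>

lemma class_K_inf_dominates_sequence:
  fixes h :: "nat \<Rightarrow> real"
  obtains g c where "g \<in> class_K_inf" "0 < c" "\<And>r. 0 \<le> r \<Longrightarrow> h (nat \<lceil>r\<rceil>) \<le> g r + c"
proof -
  \<comment> \<open>The ramp \<open>q n\<close> rises from 0 to \<open>\<bar>h (n + 2)\<bar>\<close>
    on the interval from \<open>n\<close> to \<open>n + 1\<close>. The shift by 2 makes it complete
    as soon as the ceiling of \<open>r\<close> is \<open>n + 2\<close>, that is, for
    \<open>r > n + 1\<close>. The summand \<open>r\<close> of \<open>g\<close> yields strict growth
    and unboundedness.\<close>
  define q where "q n r = \<bar>h (n + 2)\<bar> * max 0 (min 1 (r - real n))" for n r
  define g where "g r = r + (\<Sum>n<nat \<lceil>r\<rceil>. q n r)" for r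
  have q0: "0 \<le> q n r" for n r by (simp add: q_def)
  have q_mono: "q n r \<le> q n s" if "r \<le> s" for n r s
    using that unfolding q_def by (intro mult_left_mono) auto
  \<comment> \<open>The number of summands in \<open>g\<close> varies with \<open>r\<close>. Ramps
    with \<open>n \<ge> r\<close> vanish, so the sum may be taken up to any fixed
    \<open>m \<ge> r\<close>; continuity and monotonicity are then read off a fixed finite
    sum.\<close>
  have g_eq: "g r = r + (\<Sum>n<m. q n r)" if "r \<le> real m" for r m
  proof -
    have "nat \<lceil>r\<rceil> \<le> m" using that by linarith
    moreover have "q n r = 0" if "nat \<lceil>r\<rceil> \<le> n" for n
    proof -
      have "r \<le> real n" using that by linarith
      then show ?thesis by (simp add: q_def)
    qed
    ultimately have "(\<Sum>n<nat \<lceil>r\<rceil>. q n r) = (\<Sum>n<m. q n r)"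
      by (intro sum.mono_neutral_left) auto
    then show ?thesis by (simp add: g_def)
  qed
  have ge: "r \<le> g r" for r by (simp add: g_def sum_nonneg q0)
  have "isCont g r" for r
  proof -
    \<comment> \<open>The extra 1 puts \<open>r\<close> strictly below \<open>m\<close>, so one
      finite sum represents \<open>g\<close> on a whole neighbourhood of \<open>r\<close>.\<close>
    define m where "m = nat \<lceil>r\<rceil> + 1"
    have "r < real m" unfolding m_def by linarith
    then have "\<forall>\<^sub>F s in nhds r. s < real m"
      by (intro order_tendstoD(2)[OF filterlim_ident]) auto
    then have "\<forall>\<^sub>F s in nhds r. g s = s + (\<Sum>n<m. q n s)"
      by eventually_elim (simp add: g_eq)
    moreover have "isCont (\<lambda>s. s + (\<Sum>n<m. q n s)) r"
      unfolding q_def by (intro continuous_intros)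
    ultimately show ?thesis by (subst isCont_cong) auto
  qed
  then have "continuous_on {0..} g"
    by (intro continuous_at_imp_continuous_on) auto
  moreover have "strict_mono_on {0..} g"
  proof (rule strict_mono_onI)
    fix r s :: real
    assume "r < s"
    define m where "m = nat \<lceil>s\<rceil>"
    have "s \<le> real m" unfolding m_def by linarith
    moreover have "(\<Sum>n<m. q n r) \<le> (\<Sum>n<m. q n s)"
      using \<open>r < s\<close> by (intro sum_mono q_mono) auto
    ultimately show "g r < g s"
      using \<open>r < s\<close> g_eq[of r m] g_eq[of s m] by simp
  qed
  moreover have "g 0 = 0" by (simp add: g_def)
  ultimately have "g \<in> class_K"
    using ge by (auto simp: class_K_def intro: order_trans)
  then have "g \<in> class_K_inf"
    using class_K_inf_above[OF _ id_class_K_inf] ge by blast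
  \<comment> \<open>No ramp accounts for \<open>h 0\<close> and \<open>h 1\<close>, so the constant
    does; the last 1 makes it positive.\<close>
  moreover define c where "c = \<bar>h 0\<bar> + \<bar>h 1\<bar> + 1"
  have "h (nat \<lceil>r\<rceil>) \<le> g r + c" if "0 \<le> r" for r
  proof -
    have gr: "0 \<le> g r" using ge[of r] that by simp
    consider "nat \<lceil>r\<rceil> = 0" | "nat \<lceil>r\<rceil> = 1" | n where "nat \<lceil>r\<rceil> = n + 2"
      by (metis One_nat_def add_2_eq_Suc' not0_implies_Suc)
    then show ?thesis
    proof cases
      case 3
      then have "1 \<le> r - real n" by linarith
      then have "\<bar>h (nat \<lceil>r\<rceil>)\<bar> = q n r" by (simp add: q_def 3)
      also have "\<dots> \<le> (\<Sum>n<nat \<lceil>r\<rceil>. q n r)"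
        using 3 q0 by (intro member_le_sum) auto
      finally show ?thesis
        using that by (simp add: g_def c_def)
    qed (use gr in \<open>auto simp: c_def\<close>)
  qed
  ultimately show thesis
    using that[of g c] by (simp add: c_def add_nonneg_pos)
qed

section \<open>Class KL\<close>

lemma class_KL_K: "\<beta> \<in> class_KL \<Longrightarrow> 0 \<le> t \<Longrightarrow> (\<lambda>r. \<beta> r t) \<in> class_K"
  by (simp add: class_KL_def)

lemma class_KL_mono: "\<beta> \<in> class_KL \<Longrightarrow> 0 \<le> t \<Longrightarrow> 0 \<le> r \<Longrightarrow> r \<le> s \<Longrightarrow> \<beta> r t \<le> \<beta> s t"
  using class_K_mono[OF class_KL_K] .

lemma class_KL_antimono:
  assumes "\<beta> \<in> class_KL" "0 \<le> r" "0 \<le> s" "s \<le> t"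
  shows "\<beta> r t \<le> \<beta> r s"
proof (cases "r = 0 \<or> s = t")
  case True
  \<comment> \<open>Class KL prescribes decay in time only for \<open>r > 0\<close>; at
    \<open>r = 0\<close> both sides vanish.\<close>
  moreover have "\<beta> 0 s = 0" "\<beta> 0 t = 0"
    using class_KL_K[OF assms(1), of s] class_KL_K[OF assms(1), of t] assms
    by (auto simp: class_K_def)
  ultimately show ?thesis by auto
next
  case False
  then have "strict_antimono_on {0..} (\<beta> r)"
    using assms by (auto simp: class_KL_def class_L_def)
  then show ?thesis
    using monotone_onD[of "{0..}" "(<)" "(>)" "\<beta> r" s t] assms False by auto
qed

lemma class_KL_compose:
  assumes "\<beta> \<in> class_KL" "\<alpha> \<in> class_K"
  shows "(\<lambda>r. \<beta> (\<alpha> r)) \<in> class_KL"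
proof -
  have "continuous_on ({0..} \<times> {0..}) (\<lambda>(r, t). \<beta> (\<alpha> r) t)"
  proof -
    have "continuous_on {0..} \<alpha>" using assms(2) by (simp add: class_K_def)
    then have "continuous_on ({0..} \<times> {0..}) (\<lambda>z::real \<times> real. \<alpha> (fst z))"
      by (rule continuous_on_compose2[OF _ continuous_on_fst[OF continuous_on_id]]) auto
    then have "continuous_on ({0..} \<times> {0..}) (\<lambda>z::real \<times> real. (\<alpha> (fst z), snd z))"
      by (intro continuous_on_Pair continuous_on_snd continuous_on_id)
    moreover have "continuous_on ({0..} \<times> {0..}) (\<lambda>(r, t). \<beta> r t)"
      using assms(1) by (simp add: class_KL_def)
    moreover have "(\<lambda>z::real \<times> real. (\<alpha> (fst z), snd z)) ` ({0..} \<times> {0..}) \<subseteq> {0..} \<times> {0..}"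
      by (intro image_subsetI) (simp add: mem_Times_iff class_K_nonneg[OF assms(2)])
    ultimately have "continuous_on ({0..} \<times> {0..}) (\<lambda>z. (\<lambda>(r, t). \<beta> r t) (\<alpha> (fst z), snd z))"
      by (metis continuous_on_compose2)
    then show ?thesis by (simp add: case_prod_unfold)
  qed
  moreover have "(\<lambda>r. \<beta> (\<alpha> r) t) \<in> class_K" if "0 \<le> t" for t
    using class_K_compose[OF class_KL_K[OF assms(1) that] assms(2)] .
  moreover have "\<beta> (\<alpha> r) \<in> class_L" if "0 < r" for r
  proof -
    have "0 < \<alpha> r"
      using class_K_strict_mono[OF assms(2), of 0 r] that assms(2) by (simp add: class_K_def)
    then show ?thesis using assms(1) by (simp add: class_KL_def)
  qed
  ultimately show ?thesis by (simp add: class_KL_def)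
qed

text \<open>An amplitude \<open>g r\<close> that is switched off on the time scale
  \<open>g r + c\<close>. The factor \<open>exp 1\<close> keeps the value at least
  \<open>g r\<close> until time \<open>g r + c\<close>. A larger \<open>r\<close> raises the
  amplitude and slows the decay, hence the monotonicity in \<open>r\<close>.\<close>

lemma class_KL_switch:
  assumes "g \<in> class_K" "0 < c"
  shows "(\<lambda>r t. exp 1 * g r * exp (- t / (g r + c))) \<in> class_KL"
proof -
  let ?\<beta> = "\<lambda>r t. exp 1 * g r * exp (- t / (g r + c))"
  have g0: "0 \<le> g r" if "0 \<le> r" for r
    using class_K_nonneg[OF assms(1) that] .
  have pos: "0 < g r + c" if "0 \<le> r" for r
    using g0[OF that] assms(2) by simp
  have cg: "continuous_on {0..} g" using assms(1) by (simp add: class_K_def)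
  have cont: "continuous_on ({0..} \<times> {0..}) (\<lambda>(r, t). ?\<beta> r t)"
  proof -
    have "continuous_on ({0..} \<times> {0..}) (\<lambda>z::real \<times> real. g (fst z))"
      by (intro continuous_on_compose2[OF cg] continuous_intros) auto
    then show ?thesis
      unfolding case_prod_unfold by (intro continuous_intros) (auto dest: pos)
  qed
  moreover have "(\<lambda>r. ?\<beta> r t) \<in> class_K" if t: "0 \<le> t" for t
  proof -
    have "continuous_on {0..} (\<lambda>r. (\<lambda>(r, t). ?\<beta> r t) (r, t))"
      using t by (intro continuous_on_compose2[OF cont] continuous_intros) auto
    moreover have "strict_mono_on {0..} (\<lambda>r. ?\<beta> r t)"
    proof (rule strict_mono_onI)
      fix r s :: real
      assume rs: "r \<in> {0..}" "s \<in> {0..}" "r < s"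
      then have lt: "g r < g s" using class_K_strict_mono[OF assms(1)] by simp
      have "t / (g s + c) \<le> t / (g r + c)"
        using t lt pos rs by (intro divide_left_mono) auto
      then have le: "exp (- t / (g r + c)) \<le> exp (- t / (g s + c))" by simp
      show "?\<beta> r t < ?\<beta> s t"
      proof (rule mult_less_le_imp_less)
      qed (use le lt g0[of r] rs in simp_all)
    qed
    moreover have "g 0 = 0" using assms(1) by (simp add: class_K_def)
    ultimately show ?thesis using g0 by (simp add: class_K_def)
  qed
  moreover have "?\<beta> r \<in> class_L" if r: "0 < r" for r
  proof -
    have gr: "0 < g r"
      using class_K_strict_mono[OF assms(1), of 0 r] r assms(1) by (simp add: class_K_def)
    have p: "0 < g r + c" using pos r by simp
    have "filterlim (\<lambda>t. (1 / (g r + c)) * t) at_top at_top"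
      using p by (intro filterlim_tendsto_pos_mult_at_top[OF tendsto_const] filterlim_ident) auto
    then have "((\<lambda>t. exp (- ((1 / (g r + c)) * t))) \<longlongrightarrow> 0) at_top"
      by (intro filterlim_compose[OF exp_at_bot])
        (simp add: filterlim_uminus_at_top[symmetric] filterlim_uminus_at_bot)
    then have "(?\<beta> r \<longlongrightarrow> exp 1 * g r * 0) at_top"
      by (intro tendsto_intros) simp
    moreover have "strict_antimono_on {0..} (?\<beta> r)"
      using gr p by (intro monotone_onI) (auto simp: divide_strict_right_mono)
    moreover have "continuous_on {0..} (?\<beta> r)"
      by (intro continuous_intros) (use p in auto)
    ultimately show ?thesis using gr by (simp add: class_L_def)
  qed
  ultimately show ?thesis by (simp add: class_KL_def)
qed


section \<open>Distance and norm\<close>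

lemma bounded_infdist_norm:
  fixes A :: "'a::real_normed_vector set"
  assumes "bounded A" "A \<noteq> {}"
  obtains K where "0 < K" "\<And>x. infdist x A \<le> norm x + K" "\<And>x. norm x \<le> infdist x A + K"
proof -
  obtain K where K: "0 < K" "\<And>a. a \<in> A \<Longrightarrow> norm a \<le> K"
    using assms(1) by (auto simp: bounded_pos)
  obtain a where a: "a \<in> A" using assms(2) by blast
  have "infdist x A \<le> norm x + K" for x
    using infdist_le[OF a, of x] norm_triangle_ineq4[of x a] K(2)[OF a] by (simp add: dist_norm)
  moreover have "norm x \<le> infdist x A + K" for x
  proof -
    have "norm x - K \<le> dist x b" if "b \<in> A" for b
      using norm_triangle_ineq2[of x b] K(2)[OF that] by (simp add: dist_norm)
    then have "norm x - K \<le> infdist x A"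
      using assms(2) by (auto simp: infdist_def intro: cINF_greatest)
    then show ?thesis by simp
  qed
  ultimately show thesis using that K(1) by blast
qed

text \<open>Outside the ball, the radial projection of \<open>y\<close> to the sphere of radius
  \<open>R\<close> is a point of \<open>A\<close> at distance \<open>norm y - R\<close>. A set
  containing a large ball thus subtracts a constant from norm estimates.\<close>

lemma infdist_superset_cball:
  fixes A :: "'a::real_normed_vector set"
  assumes "cball 0 R \<subseteq> A" "0 \<le> R"
  shows "infdist y A \<le> max 0 (norm y - R)"
proof (cases "norm y \<le> R")
  case True
  then have "y \<in> A" using assms(1) by auto
  then show ?thesis by simp
next
  case False
  define z where "z = (R / norm y) *\<^sub>R y"
  have "z \<in> A" using assms False by (intro subsetD[OF assms(1)]) (simp add: z_def)
  then have "infdist y A \<le> dist y z" by (rule infdist_le)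
  also have "y - z = (1 - R / norm y) *\<^sub>R y" by (simp add: z_def algebra_simps)
  then have "dist y z = (1 - R / norm y) * norm y"
    using False assms(2) by (simp add: dist_norm divide_simps)
  also have "\<dots> = norm y - R" using False assms(2) by (auto simp: field_simps)
  finally show ?thesis by simp
qed


section \<open>The equivalences\<close>

text \<open>The norm axioms give this through \<open>v - v\<close>: its norm is 0 and at most
  \<open>2 * normU v\<close>.\<close>

lemma (in input_space) normU_nonneg:
  assumes "v \<in> V"
  shows "0 \<le> normU v"
proof -
  have "normU (\<lambda>t. v t + (- 1) *\<^sub>R v t) \<le> normU v + normU (\<lambda>t. (- 1) *\<^sub>R v t)"
    using assms V_scale[of v "- 1"] by (intro normU_triangle)
  also have "\<dots> = 2 * normU v" using normU_scale[OF assms, of "- 1"] by simp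
  finally show ?thesis using normU_eq_0[OF V_zero] by simp
qed

lemma ISpS_wrt_of_CUAG_wrt:
  assumes "CUAG_wrt normU \<U> \<phi> A"
  shows "ISpS_wrt normU \<U> \<phi> A"
proof -
  from assms obtain \<beta> \<gamma> C where \<beta>: "\<beta> \<in> class_KL" and \<gamma>: "\<gamma> \<in> class_K_inf" and C: "0 < C"
    and bd: "\<And>x u t. u \<in> \<U> \<Longrightarrow> 0 \<le> t \<Longrightarrow> infdist (\<phi> t x u) A \<le> \<beta> (infdist x A + C) t + \<gamma> (normU u)"
    unfolding CUAG_wrt_def by blast
  have "\<beta> (2 * C) 0 > 0"
    using class_K_strict_mono[OF class_KL_K[OF \<beta>, of 0], of 0 "2 * C"] C class_KL_K[OF \<beta>, of 0]
    by (simp add: class_K_def)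
  moreover have "infdist (\<phi> t x u) A \<le> \<beta> (2 * infdist x A) t + \<gamma> (normU u) + \<beta> (2 * C) 0"
    if "u \<in> \<U>" "0 \<le> t" for x u t
    using bd[OF that, of x] class_K_add_le[OF class_KL_K[OF \<beta> that(2)], of "infdist x A" C]
      class_KL_antimono[OF \<beta>, of "2 * C" 0 t] C that(2) infdist_nonneg[of x A] by simp
  moreover have "(\<lambda>r. \<beta> (2 * r)) \<in> class_KL"
    using class_KL_compose[OF \<beta> class_K_scale] by simp
  ultimately show ?thesis
    unfolding ISpS_wrt_def using \<gamma>
    by (intro bexI[of _ "\<lambda>r. \<beta> (2 * r)"] bexI[of _ \<gamma>] exI[of _ "\<beta> (2 * C) 0"]) auto
qed

section \<open>Consequences of ISpS and of CUAG\<close>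

context control_system
begin

lemma input_norm_nonneg: "u \<in> \<U> \<Longrightarrow> 0 \<le> normU u"
  using normU_nonneg inputs_subset by blast

text \<open>Passing to norms removes the set from the estimate, so that another set can be chosen
  later. The bound \<open>K\<close> on its elements enters once at the initial state, inside
  \<open>\<beta>\<close>, and once at the final state, inside \<open>c\<close>.\<close>

lemma ISpS_norm_bound:
  assumes "ISpS normU \<U> \<phi>"
  obtains \<beta> \<gamma> K c where "\<beta> \<in> class_KL" "\<gamma> \<in> class_K_inf" "0 < K" "0 < c"
    "\<And>x u t. u \<in> \<U> \<Longrightarrow> 0 \<le> t \<Longrightarrow> norm (\<phi> t x u) \<le> \<beta> (norm x + K) t + \<gamma> (normU u) + c"
proof -
  from assms obtain A where A: "bounded A" "A \<noteq> {}" "ISpS_wrt normU \<U> \<phi> A"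
    unfolding ISpS_def by blast
  from A(3) obtain \<beta> \<gamma> c where \<beta>: "\<beta> \<in> class_KL" and \<gamma>: "\<gamma> \<in> class_K_inf" and c: "0 < c"
    and bd: "\<And>x u t. u \<in> \<U> \<Longrightarrow> 0 \<le> t \<Longrightarrow> infdist (\<phi> t x u) A \<le> \<beta> (infdist x A) t + \<gamma> (normU u) + c"
    unfolding ISpS_wrt_def by blast
  obtain K where K: "0 < K" "\<And>x. infdist x A \<le> norm x + K" "\<And>x. norm x \<le> infdist x A + K"
    by (rule bounded_infdist_norm[OF A(1,2)], rule that)
  have "norm (\<phi> t x u) \<le> \<beta> (norm x + K) t + \<gamma> (normU u) + (c + K)" if "u \<in> \<U>" "0 \<le> t" for x u t
    using bd[OF that, of x] class_KL_mono[OF \<beta> that(2) infdist_nonneg K(2), of x] K(3)[of "\<phi> t x u"]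
    by linarith
  then show thesis using that[OF \<beta> \<gamma> K(1), of "c + K"] c K(1) by simp
qed

lemma ISpS_imp_CUAG:
  assumes "ISpS normU \<U> \<phi>"
  shows "\<exists>A. bounded A \<and> A \<noteq> {} \<and> zero_invariant \<phi> A \<and> CUAG_wrt normU \<U> \<phi> A"
proof -
  obtain \<beta> \<gamma> K c where \<beta>: "\<beta> \<in> class_KL" and \<gamma>: "\<gamma> \<in> class_K_inf" and pos: "0 < K" "0 < c"
    and bd: "\<And>x u t. u \<in> \<U> \<Longrightarrow> 0 \<le> t \<Longrightarrow> norm (\<phi> t x u) \<le> \<beta> (norm x + K) t + \<gamma> (normU u) + c"
    by (rule ISpS_norm_bound[OF assms], rule that)
  \<comment> \<open>The ball alone may fail to be invariant, so everything reached from it with zero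
    input is added. Time 0 puts the ball itself into \<open>A\<close>, and the ISpS bound keeps
    \<open>A\<close> bounded.\<close>
  define A where "A = {\<phi> t x (\<lambda>_. 0) | t x. 0 \<le> t \<and> norm x \<le> c}"
  have ball: "cball 0 c \<subseteq> A"
  proof
    fix x :: 'x
    assume "x \<in> cball 0 c"
    then have "norm x \<le> c" by simp
    with initial[OF zero_input, of x, symmetric] show "x \<in> A"
      unfolding A_def by (intro CollectI exI[of _ 0] exI[of _ x]) simp
  qed
  then have ne: "A \<noteq> {}" using pos by auto
  have "norm (\<phi> t x (\<lambda>_. 0)) \<le> \<beta> (c + K) 0 + c" if "0 \<le> t" "norm x \<le> c" for t x
  proof -
    have "\<gamma> (normU (\<lambda>_. 0)) = 0"
      using normU_eq_0[OF V_zero] class_K_inf_K[OF \<gamma>] by (simp add: class_K_def)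
    moreover have "\<beta> (norm x + K) t \<le> \<beta> (c + K) t"
      using class_KL_mono[OF \<beta>] that pos by simp
    moreover have "\<beta> (c + K) t \<le> \<beta> (c + K) 0"
      using class_KL_antimono[OF \<beta>] that pos by simp
    ultimately show ?thesis using bd[OF zero_input that(1), of x] by simp
  qed
  then have bA: "bounded A"
    unfolding A_def by (intro boundedI[of _ "\<beta> (c + K) 0 + c"]) auto
  \<comment> \<open>The zero input is its own shift, so the cocycle law becomes a semigroup law,
    which makes \<open>A\<close> invariant.\<close>
  have "shift_input t (\<lambda>_. 0 :: 'u) = (\<lambda>_. 0)" for t
    by (simp add: shift_input_def)
  then have "\<phi> h (\<phi> t x (\<lambda>_. 0)) (\<lambda>_. 0) = \<phi> (t + h) x (\<lambda>_. 0)" if "0 \<le> t" "0 \<le> h" for t h x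
    using cocycle[OF zero_input that, of x] by simp
  then have inv: "zero_invariant \<phi> A"
    unfolding zero_invariant_def A_def by clarify (metis add_nonneg_nonneg)
  obtain L where L: "0 < L" "\<And>x. norm x \<le> infdist x A + L"
    using bounded_infdist_norm[OF bA ne] by metis
  \<comment> \<open>\<open>L\<close> converts \<open>norm x\<close> into the distance from
    \<open>A\<close>, and \<open>K\<close> already stands inside \<open>\<beta>\<close>. The offset
    \<open>c\<close> cancels against the radius of the ball.\<close>
  have "infdist (\<phi> t x u) A \<le> \<beta> (infdist x A + (L + K)) t + \<gamma> (normU u)" if "u \<in> \<U>" "0 \<le> t" for x u t
  proof -
    have "infdist (\<phi> t x u) A \<le> max 0 (norm (\<phi> t x u) - c)"
      using infdist_superset_cball[OF ball] pos by simp
    moreover have "\<beta> (norm x + K) t \<le> \<beta> (infdist x A + (L + K)) t"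
      using class_KL_mono[OF \<beta> that(2), of "norm x + K"] L(2)[of x] pos by simp
    moreover have "0 \<le> \<beta> (norm x + K) t"
      using class_K_nonneg[OF class_KL_K[OF \<beta> that(2)]] pos by simp
    moreover have "0 \<le> \<gamma> (normU u)"
      using class_K_nonneg[OF class_K_inf_K[OF \<gamma>] input_norm_nonneg[OF that(1)]] .
    ultimately show ?thesis using bd[OF that, of x] by linarith
  qed
  then have "CUAG_wrt normU \<U> \<phi> A"
    unfolding CUAG_wrt_def using \<beta> \<gamma> pos L(1)
    by (intro bexI[of _ \<beta>] bexI[of _ \<gamma>] exI[of _ "L + K"]) auto
  with bA ne inv show ?thesis by blast
qed

lemma ISpS_imp_BRS:
  assumes "ISpS normU \<U> \<phi>"
  shows "BRS normU \<U> \<phi>"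
proof -
  obtain \<beta> \<gamma> K c where \<beta>: "\<beta> \<in> class_KL" and \<gamma>: "\<gamma> \<in> class_K_inf" and pos: "0 < K" "0 < c"
    and bd: "\<And>x u t. u \<in> \<U> \<Longrightarrow> 0 \<le> t \<Longrightarrow> norm (\<phi> t x u) \<le> \<beta> (norm x + K) t + \<gamma> (normU u) + c"
    by (rule ISpS_norm_bound[OF assms], rule that)
  have "norm (\<phi> t x u) \<le> \<beta> (C + K) 0 + \<gamma> C + c"
    if "norm x \<le> C" "u \<in> \<U>" "normU u \<le> C" "0 \<le> t" for C t x u
  proof -
    have "0 \<le> C + K" using that pos norm_ge_zero[of x] by linarith
    then have "\<beta> (C + K) t \<le> \<beta> (C + K) 0"
      using class_KL_antimono[OF \<beta>] that by simp
    moreover have "\<beta> (norm x + K) t \<le> \<beta> (C + K) t"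
      using class_KL_mono[OF \<beta>] that pos by simp
    moreover have "\<gamma> (normU u) \<le> \<gamma> C"
      using class_K_mono[OF class_K_inf_K[OF \<gamma>] input_norm_nonneg] that by simp
    ultimately show ?thesis using bd[OF that(2,4), of x] by linarith
  qed
  then show ?thesis unfolding BRS_def bdd_above_def by fastforce
qed

text \<open>Since \<open>\<beta> (r + C)\<close> tends to 0, a single instant \<open>\<tau>\<close>,
  depending on \<open>\<epsilon>\<close> and \<open>r\<close> only, serves as hitting time for all
  states and inputs at once.\<close>

lemma CUAG_wrt_imp_ULIM_wrt:
  assumes "CUAG_wrt normU \<U> \<phi> A"
  shows "ULIM_wrt normU \<U> \<phi> A"
proof -
  from assms obtain \<beta> \<gamma> C where \<beta>: "\<beta> \<in> class_KL" and \<gamma>: "\<gamma> \<in> class_K_inf" and C: "0 < C"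
    and bd: "\<And>x u t. u \<in> \<U> \<Longrightarrow> 0 \<le> t \<Longrightarrow> infdist (\<phi> t x u) A \<le> \<beta> (infdist x A + C) t + \<gamma> (normU u)"
    unfolding CUAG_wrt_def by blast
  have "\<exists>\<tau>. \<forall>u\<in>\<U>. \<forall>x. infdist x A \<le> r \<longrightarrow>
          (\<exists>t. 0 \<le> t \<and> t \<le> \<tau> \<and> infdist (\<phi> t x u) A \<le> \<epsilon> + \<gamma> (normU u))"
    if "0 < \<epsilon>" "0 < r" for \<epsilon> r :: real
  proof -
    have "(\<beta> (r + C) \<longlongrightarrow> 0) at_top"
      using \<beta> that C by (auto simp: class_KL_def class_L_def)
    then have "\<forall>\<^sub>F t in at_top. \<beta> (r + C) t < \<epsilon> \<and> 0 \<le> t"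
      using that by (intro eventually_conj order_tendstoD(2) eventually_ge_at_top)
    then obtain \<tau> where \<tau>: "\<beta> (r + C) \<tau> < \<epsilon>" "0 \<le> \<tau>"
      using eventually_happens'[OF trivial_limit_at_top_linorder] by blast
    have "infdist (\<phi> \<tau> x u) A \<le> \<epsilon> + \<gamma> (normU u)" if "u \<in> \<U>" "infdist x A \<le> r" for x u
      using bd[OF that(1) \<tau>(2), of x] class_KL_mono[OF \<beta> \<tau>(2), of "infdist x A + C" "r + C"]
        that(2) C \<tau>(1) infdist_nonneg[of x A] by simp
    with \<tau>(2) show ?thesis by (intro exI[of _ \<tau>]) blast
  qed
  with \<gamma> show ?thesis unfolding ULIM_wrt_def by blast
qed

section \<open>From BRS and ULIM to ISpS\<close>

lemma BRS_bound:
  assumes "BRS normU \<U> \<phi>"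
  obtains B where "\<And>x u t. norm x \<le> C \<Longrightarrow> u \<in> \<U> \<Longrightarrow> normU u \<le> C \<Longrightarrow> 0 \<le> t \<Longrightarrow> t \<le> \<tau> \<Longrightarrow> norm (\<phi> t x u) \<le> B"
proof -
  \<comment> \<open>BRS speaks of positive radii and horizons; the maxima with 1 admit arbitrary
    \<open>C\<close> and \<open>\<tau>\<close>.\<close>
  let ?S = "{norm (\<phi> t x u) | t x u.
      norm x \<le> max 1 C \<and> u \<in> \<U> \<and> normU u \<le> max 1 C \<and> t \<in> {0..max 1 \<tau>}}"
  have "bdd_above ?S"
    by (rule assms[unfolded BRS_def, rule_format]) auto
  then obtain B where B: "\<forall>b\<in>?S. b \<le> B"
    unfolding bdd_above_def by (elim exE)
  show thesis
  proof (rule that[of B])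
    fix x :: 'x and u t
    assume "norm x \<le> C" "u \<in> \<U>" "normU u \<le> C" "0 \<le> t" "t \<le> \<tau>"
    then have "norm (\<phi> t x u) \<in> ?S"
      by (intro CollectI exI[of _ t] exI[of _ x] exI[of _ u]) auto
    with B show "norm (\<phi> t x u) \<le> B" by (rule bspec)
  qed
qed

text \<open>A trajectory starting in the ball of radius \<open>R\<close> is back in it at some time
  between 1 and \<open>1 + \<tau>\<close>. BRS bounds it up to time \<open>1 + \<tau>\<close>, hence
  until that return, and the argument restarts there. Each round consumes at least one unit of time,
  so induction over an integer bound on \<open>t\<close> reaches every time.\<close>

lemma attraction_imp_bounded:
  assumes "BRS normU \<U> \<phi>" "\<gamma> \<in> class_K"
    and attr: "\<And>r. \<exists>\<tau>. \<forall>u\<in>\<U>. \<forall>x. norm x \<le> r \<longrightarrow>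
      (\<exists>t. 0 \<le> t \<and> t \<le> \<tau> \<and> norm (\<phi> t x u) \<le> a + \<gamma> (normU u))"
  shows "\<exists>M. \<forall>u\<in>\<U>. \<forall>x. \<forall>t\<ge>0. norm x \<le> r \<longrightarrow> normU u \<le> r \<longrightarrow> norm (\<phi> t x u) \<le> M"
proof -
  \<comment> \<open>Large enough for the initial states, the inputs, and the ball into which inputs
    of norm at most \<open>r\<close> allow a return.\<close>
  define R where "R = max r (a + \<gamma> r)"
  obtain R1 where R1: "\<And>x u t. norm x \<le> R \<Longrightarrow> u \<in> \<U> \<Longrightarrow> normU u \<le> R \<Longrightarrow> 0 \<le> t \<Longrightarrow> t \<le> 1 \<Longrightarrow> norm (\<phi> t x u) \<le> R1"
    by (rule BRS_bound[OF assms(1), where C = R and \<tau> = 1], rule that)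
  obtain \<tau> where \<tau>: "\<And>x u. u \<in> \<U> \<Longrightarrow> norm x \<le> R1 \<Longrightarrow> \<exists>t. 0 \<le> t \<and> t \<le> \<tau> \<and> norm (\<phi> t x u) \<le> a + \<gamma> (normU u)"
    using attr[of R1] by blast
  obtain M where M: "\<And>x u t. norm x \<le> R \<Longrightarrow> u \<in> \<U> \<Longrightarrow> normU u \<le> R \<Longrightarrow> 0 \<le> t \<Longrightarrow> t \<le> 1 + \<tau> \<Longrightarrow> norm (\<phi> t x u) \<le> M"
    by (rule BRS_bound[OF assms(1), where C = R and \<tau> = "1 + \<tau>"], rule that)
  have bd: "norm (\<phi> t x u) \<le> M"
    if "u \<in> \<U>" "norm x \<le> R" "normU u \<le> r" "0 \<le> t" "t \<le> real n" for n t x u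
    using that
  proof (induction n arbitrary: t x u)
    case 0
    \<comment> \<open>Here \<open>t = 0\<close>, and \<open>M\<close> applies once
      \<open>1 + \<tau>\<close> is nonnegative; \<open>\<tau>\<close> is, because some hitting time
      lies between 0 and \<open>\<tau>\<close>.\<close>
    have "0 \<le> \<tau>"
      using \<tau>[OF zero_input, of "\<phi> 0 x u"] R1[of x u 0] 0 by (force simp: R_def)
    with 0 show ?case by (intro M) (auto simp: R_def)
  next
    case (Suc n)
    have uR: "normU u \<le> R" using Suc.prems by (simp add: R_def)
    \<comment> \<open>Attraction might be immediate. Waiting one unit first makes the return time
      \<open>1 + s\<close> at least 1.\<close>
    define y where "y = \<phi> 1 x u"
    define v where "v = shift_input 1 u"
    have v: "v \<in> \<U>" "normU v \<le> normU u"
      using shift_closed shift_norm Suc.prems by (auto simp: v_def)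
    have "norm y \<le> R1" using R1 Suc.prems uR by (simp add: y_def)
    then obtain s where s: "0 \<le> s" "s \<le> \<tau>" "norm (\<phi> s y v) \<le> a + \<gamma> (normU v)"
      using \<tau> v by blast
    show ?case
    proof (cases "t \<le> 1 + \<tau>")
      case True
      then show ?thesis using M Suc.prems uR by blast
    next
      case False
      have "\<phi> s y v = \<phi> (1 + s) x u"
        using cocycle[of u 1 s x] Suc.prems s by (simp add: y_def v_def)
      moreover have "\<gamma> (normU v) \<le> \<gamma> r"
        using class_K_mono[OF assms(2) input_norm_nonneg[OF v(1)]] v Suc.prems by simp
      ultimately have "norm (\<phi> (1 + s) x u) \<le> R" using s by (simp add: R_def)
      moreover have "shift_input (1 + s) u \<in> \<U>" "normU (shift_input (1 + s) u) \<le> r"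
        using shift_closed[of u "1 + s"] shift_norm[of u "1 + s"] s Suc.prems by auto
      \<comment> \<open>The remaining time is at most \<open>n\<close>, and shifting keeps the input
        norm below \<open>r\<close>.\<close>
      ultimately have "norm (\<phi> (t - (1 + s)) (\<phi> (1 + s) x u) (shift_input (1 + s) u)) \<le> M"
        using False s Suc.prems by (intro Suc.IH) auto
      then show ?thesis
        using cocycle[of u "1 + s" "t - (1 + s)" x] False s Suc.prems by simp
    qed
  qed
  show ?thesis
  proof (intro exI ballI allI impI)
    fix u and x :: 'x and t :: real
    assume "u \<in> \<U>" "0 \<le> t" "norm x \<le> r" "normU u \<le> r"
    moreover obtain n where "t \<le> real n" using real_arch_simple by blast
    ultimately show "norm (\<phi> t x u) \<le> M"
      by (intro bd[of u x t n]) (simp_all add: R_def)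
  qed
qed

lemma BRS_ULIM_imp_ISpS:
  assumes "BRS normU \<U> \<phi>" "bounded A" "A \<noteq> {}" "ULIM_wrt normU \<U> \<phi> A"
  shows "ISpS normU \<U> \<phi>"
proof -
  from assms(4) obtain \<gamma> where \<gamma>: "\<gamma> \<in> class_K_inf"
    and lim: "\<And>r. 0 < r \<Longrightarrow> \<exists>\<tau>. \<forall>u\<in>\<U>. \<forall>x. infdist x A \<le> r \<longrightarrow>
      (\<exists>t. 0 \<le> t \<and> t \<le> \<tau> \<and> infdist (\<phi> t x u) A \<le> 1 + \<gamma> (normU u))"
    unfolding ULIM_wrt_def by (metis zero_less_one)
  obtain K where K: "0 < K" "\<And>x. infdist x A \<le> norm x + K" "\<And>x. norm x \<le> infdist x A + K"
    by (rule bounded_infdist_norm[OF assms(2,3)], rule that)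
  \<comment> \<open>The 1 is the chosen \<open>\<epsilon>\<close>, harmless because ISpS tolerates a
    constant offset; \<open>K\<close> converts distance into norm.\<close>
  define a where "a = 1 + K"
  have a: "0 \<le> a" using K(1) by (simp add: a_def)
  have attr: "\<exists>\<tau>. \<forall>u\<in>\<U>. \<forall>x. norm x \<le> r \<longrightarrow>
      (\<exists>t. 0 \<le> t \<and> t \<le> \<tau> \<and> norm (\<phi> t x u) \<le> a + \<gamma> (normU u))" for r
  proof -
    have "0 < max 0 r + K" using K(1) by simp
    then obtain \<tau> where \<tau>: "\<forall>u\<in>\<U>. \<forall>x. infdist x A \<le> max 0 r + K \<longrightarrow>
      (\<exists>t. 0 \<le> t \<and> t \<le> \<tau> \<and> infdist (\<phi> t x u) A \<le> 1 + \<gamma> (normU u))"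
      using lim by blast
    have "\<exists>t. 0 \<le> t \<and> t \<le> \<tau> \<and> norm (\<phi> t x u) \<le> a + \<gamma> (normU u)" if "u \<in> \<U>" "norm x \<le> r" for x u
    proof -
      have "infdist x A \<le> max 0 r + K" using K(2)[of x] that by simp
      from \<tau>[rule_format, OF that(1) this]
      obtain t where t: "0 \<le> t" "t \<le> \<tau>" "infdist (\<phi> t x u) A \<le> 1 + \<gamma> (normU u)"
        by (elim exE conjE)
      with K(3)[of "\<phi> t x u"] have "norm (\<phi> t x u) \<le> a + \<gamma> (normU u)"
        by (simp add: a_def)
      with t(1,2) show ?thesis by (intro exI conjI)
    qed
    then show ?thesis by blast
  qed
  have \<gamma>K: "\<gamma> \<in> class_K" using \<gamma> by (rule class_K_inf_K)
  have "\<forall>n. \<exists>M. \<forall>u\<in>\<U>. \<forall>x. \<forall>t\<ge>0. norm x \<le> real n \<longrightarrow> normU u \<le> real n \<longrightarrow> norm (\<phi> t x u) \<le> M"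
    by (intro allI attraction_imp_bounded[OF assms(1) \<gamma>K, of a] attr)
  from choice[OF this] obtain M where M: "\<forall>n. \<forall>u\<in>\<U>. \<forall>x. \<forall>t\<ge>0.
      norm x \<le> real n \<longrightarrow> normU u \<le> real n \<longrightarrow> norm (\<phi> t x u) \<le> M n" ..
  have "\<forall>n::nat. \<exists>\<tau>. \<forall>u\<in>\<U>. \<forall>x. norm x \<le> real n \<longrightarrow>
      (\<exists>t. 0 \<le> t \<and> t \<le> \<tau> \<and> norm (\<phi> t x u) \<le> a + \<gamma> (normU u))"
    by (intro allI attr)
  from choice[OF this] obtain T where T: "\<forall>n. \<forall>u\<in>\<U>. \<forall>x. norm x \<le> real n \<longrightarrow>
      (\<exists>t. 0 \<le> t \<and> t \<le> T n \<and> norm (\<phi> t x u) \<le> a + \<gamma> (normU u))" ..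
  \<comment> \<open>One \<open>g\<close> dominates both the bounds \<open>M\<close> and the
    attraction times \<open>T\<close>, so amplitude and time scale of \<open>\<beta>\<close> come
    from the same function.\<close>
  obtain g c where g: "g \<in> class_K_inf" and c: "0 < c"
    and dom: "\<And>r. 0 \<le> r \<Longrightarrow> max (M (nat \<lceil>r\<rceil>)) (T (nat \<lceil>r\<rceil>)) \<le> g r + c"
    by (rule class_K_inf_dominates_sequence[of "\<lambda>n. max (M n) (T n)"], rule that)
  have gK: "g \<in> class_K" using g by (rule class_K_inf_K)
  have bd: "norm (\<phi> t x u) \<le> g (norm x) + g (normU u) + c" if "u \<in> \<U>" "0 \<le> t" for t x u
  proof -
    define m where "m = max (norm x) (normU u)"
    have "norm (\<phi> t x u) \<le> M (nat \<lceil>m\<rceil>)"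
    proof (rule M[rule_format, OF that])
      have "m \<le> real (nat \<lceil>m\<rceil>)" by linarith
      then show "norm x \<le> real (nat \<lceil>m\<rceil>)" "normU u \<le> real (nat \<lceil>m\<rceil>)"
        by (simp_all add: m_def)
    qed
    also have "\<dots> \<le> g m + c" using dom[of m] by (simp add: m_def max.coboundedI1)
    also have "g m \<le> g (norm x) + g (normU u)"
      using class_K_nonneg[OF gK norm_ge_zero, of x]
        class_K_nonneg[OF gK input_norm_nonneg[OF that(1)]] by (auto simp: m_def max_def)
    finally show ?thesis by simp
  qed
  have hit: "\<exists>t. 0 \<le> t \<and> t \<le> g (norm x) + c \<and> norm (\<phi> t x u) \<le> a + \<gamma> (normU u)" if "u \<in> \<U>" for x u
  proof -
    have "norm x \<le> real (nat \<lceil>norm x\<rceil>)" by linarith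
    from T[rule_format, OF that this] obtain t
      where t: "0 \<le> t" "t \<le> T (nat \<lceil>norm x\<rceil>)" "norm (\<phi> t x u) \<le> a + \<gamma> (normU u)"
      by (elim exE conjE)
    moreover have "t \<le> g (norm x) + c" using t(2) dom[of "norm x"] by simp
    ultimately show ?thesis by (intro exI conjI)
  qed
  \<comment> \<open>\<open>\<beta>\<close> bounds the transient up to the first visit. In
    \<open>\<delta>\<close>, the term \<open>g (2 * \<gamma> r)\<close> pays for the radius of the
    visited ball and \<open>g r\<close> for the input acting afterwards.\<close>
  define \<beta> where "\<beta> r t = exp 1 * g r * exp (- t / (g r + c))" for r t
  define \<delta> where "\<delta> r = g (2 * \<gamma> r) + g r" for r
  have \<beta>: "\<beta> \<in> class_KL"
    using class_KL_switch[OF gK c] by (simp add: \<beta>_def[abs_def])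
  have g2: "0 \<le> g (2 * \<gamma> r)" if "0 \<le> r" for r
    using class_K_nonneg[OF gK] class_K_nonneg[OF \<gamma>K that] by simp
  have "\<delta> \<in> class_K"
    unfolding \<delta>_def[abs_def]
    by (intro class_K_add gK class_K_compose[OF gK] class_K_compose[OF class_K_scale \<gamma>K]) simp
  then have \<delta>: "\<delta> \<in> class_K_inf"
    using class_K_inf_above[OF _ g] g2 by (simp add: \<delta>_def)
  have ga: "0 \<le> g (2 * a)" using class_K_nonneg[OF gK] a by simp
  have "norm (\<phi> t x u) \<le> \<beta> (norm x) t + \<delta> (normU u) + (g (2 * a) + c)" if u: "u \<in> \<U>" and t: "0 \<le> t" for t x u
  proof (cases "t \<le> g (norm x) + c")
    case True
    \<comment> \<open>Up to the deadline the exponent is at least -1, so \<open>exp 1\<close>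
      compensates the decay and \<open>bd\<close> suffices.\<close>
    have gx: "0 \<le> g (norm x)" using class_K_nonneg[OF gK] by simp
    then have "t / (g (norm x) + c) \<le> 1" using True c by simp
    then have "1 \<le> exp 1 * exp (- t / (g (norm x) + c))"
      by (simp flip: exp_add)
    then have "g (norm x) * 1 \<le> g (norm x) * (exp 1 * exp (- t / (g (norm x) + c)))"
      using gx by (intro mult_left_mono)
    then have "g (norm x) \<le> \<beta> (norm x) t" by (simp add: \<beta>_def mult_ac)
    then show ?thesis
      using bd[OF u t, of x] g2[OF input_norm_nonneg[OF u]] ga by (simp add: \<delta>_def)
  next
    case False
    \<comment> \<open>After the deadline \<open>bd\<close> is restarted at the visit time
      \<open>s\<close>, where the norm of the state is bounded in terms of the input alone; of
      \<open>\<beta>\<close> only nonnegativity enters.\<close>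
    obtain s where s: "0 \<le> s" "s \<le> g (norm x) + c" "norm (\<phi> s x u) \<le> a + \<gamma> (normU u)"
      using hit[OF u] by blast
    define v where "v = shift_input s u"
    have v: "v \<in> \<U>" "normU v \<le> normU u"
      using shift_closed shift_norm u s by (auto simp: v_def)
    have "\<phi> t x u = \<phi> (t - s) (\<phi> s x u) v"
      using cocycle[OF u s(1), of "t - s" x] s False by (simp add: v_def)
    then have "norm (\<phi> t x u) \<le> g (norm (\<phi> s x u)) + g (normU v) + c"
      using bd[OF v(1), of "t - s" "\<phi> s x u"] s False by simp
    moreover have "g (normU v) \<le> g (normU u)"
      using class_K_mono[OF gK input_norm_nonneg[OF v(1)] v(2)] .
    moreover have "g (norm (\<phi> s x u)) \<le> g (a + \<gamma> (normU u))"
      using class_K_mono[OF gK norm_ge_zero s(3)] .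
    moreover have "\<dots> \<le> g (2 * a) + g (2 * \<gamma> (normU u))"
      using class_K_add_le[OF gK a] class_K_nonneg[OF \<gamma>K input_norm_nonneg[OF u]] by blast
    moreover have "0 \<le> \<beta> (norm x) t"
      using class_K_nonneg[OF class_KL_K[OF \<beta> t]] by simp
    ultimately show ?thesis by (simp add: \<delta>_def)
  qed
  \<comment> \<open>The estimate is in norms, which are distances from the origin.\<close>
  then have "ISpS_wrt normU \<U> \<phi> {0}"
    unfolding ISpS_wrt_def using \<beta> \<delta> ga c
    by (intro bexI[of _ \<beta>] bexI[of _ \<delta>] exI[of _ "g (2 * a) + c"])
      (auto simp: infdist_singleton)
  then show ?thesis unfolding ISpS_def by (intro exI[of _ "{0}"]) simp
qed

end

theorem mainTheorem1:
  fixes V :: "(real \<Rightarrow> 'u::real_normed_vector) set"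
    and normU :: "(real \<Rightarrow> 'u) \<Rightarrow> real"
    and U :: "'u set"
    and \<U> :: "(real \<Rightarrow> 'u) set"
    and \<phi> :: "real \<Rightarrow> 'x::real_normed_vector \<Rightarrow> (real \<Rightarrow> 'u) \<Rightarrow> 'x"
  assumes "control_system V normU U \<U> \<phi>"
  shows "(ISpS normU \<U> \<phi> \<longleftrightarrow>
            (\<exists>A. bounded A \<and> A \<noteq> {} \<and> zero_invariant \<phi> A \<and> CUAG_wrt normU \<U> \<phi> A)) \<and>
         (ISpS normU \<U> \<phi> \<longleftrightarrow>
            BRS normU \<U> \<phi> \<and> (\<exists>A. bounded A \<and> A \<noteq> {} \<and> ULIM_wrt normU \<U> \<phi> A))"
proof -
  interpret control_system V normU U \<U> \<phi> by fact
  show ?thesis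
    \<comment> \<open>ULIM is reached from ISpS through CUAG, with the same set
      \<open>A\<close>.\<close>
    using ISpS_imp_CUAG ISpS_imp_BRS CUAG_wrt_imp_ULIM_wrt BRS_ULIM_imp_ISpS
      ISpS_wrt_of_CUAG_wrt ISpS_def by metis
qed

end
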